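(* Let $\mathbf u$ be an infinite word over a finite alphabet whose language is closed under reversal, and suppose that: (1) both $D(\mathbf u)$ and $\sum_{n=0}^{+\infty}T_{\mathbf u}(n)$ are finite; (2) for every $M\in\mathbb N$ there exists a factor $w\in\mathcal L(\mathbf u)$ such that $w$ contains every factor of $\mathbf u$ of length $M$ and $ww\in\mathcal L(\mathbf u)$. Then $2D(\mathbf u)=\sum_{n=0}^{+\infty}T_{\mathbf u}(n)$.
   Context: $\mathcal L(\mathbf u)$ is the set of finite factors of $\mathbf u$, $\mathcal L_n(\mathbf u)$ those of length $n$. The reversal of $w=w_0\ldots w_{n-1}$ is $\overline w=w_{n-1}\ldots w_0$; a palindrome is a word equal to its reversal (including the empty word). The language is closed under reversal if $w\in\mathcal L(\mathbf u)$ implies $\overline w\in\mathcal L(\mathbf u)$. $\mathcal C_{\mathbf u}(n)=\#\mathcal L_n(\mathbf u)$; $\mathcal P_{\mathbf u}(n)$ is the number of palindromes in $\mathcal L_n(\mathbf u)$; $T_{\mathbf u}(n)=\mathcal C_{\mathbf u}(n+1)-\mathcal C_{\mathbf u}(n)+2-\mathcal P_{\mathbf u}(n+1)-\mathcal P_{\mathbf u}(n)$. The defect of a finite word $w$ is $D(w)=|w|+1$ minus the number of distinct palindromic factors of $w$ (including the empty word); $D(\mathbf u)=\sup\{D(w): w \text{ prefix of }\mathbf u\}$. *)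

theory Defs
  imports "HOL-Library.Sublist" "HOL-Library.Extended_Real" "HOL-Library.Omega_Words_Fun"
begin

text \<open>
  Infinite words are functions on the natural numbers (type \<open>'a word\<close>), and
  \<open>u [i \<rightarrow> j]\<close> is the finite word \<open>u\<^sub>i \<dots> u\<^sub>j\<^sub>-\<^sub>1\<close>. The name
  \<open>prefix\<close> refers to \<open>Omega_Words_Fun.prefix\<close>: \<open>prefix n u\<close> is the
  prefix of length \<open>n\<close> of \<open>u\<close>. For finite words, \<open>sublist v w\<close> says that
  \<open>v\<close> is a (contiguous) factor of \<open>w\<close>.
\<close>

definition language :: "'a word \<Rightarrow> 'a list set" where
  "language u = {u [i \<rightarrow> i + n] | i n. True}"

definition language_n :: "'a word \<Rightarrow> nat \<Rightarrow> 'a list set" where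
  "language_n u n = {w \<in> language u. length w = n}"

definition palindrome :: "'a list \<Rightarrow> bool" where
  "palindrome w \<longleftrightarrow> rev w = w"

definition closed_under_reversal :: "'a word \<Rightarrow> bool" where
  "closed_under_reversal u \<longleftrightarrow> (\<forall>w \<in> language u. rev w \<in> language u)"

definition factor_complexity :: "'a word \<Rightarrow> nat \<Rightarrow> nat" where
  "factor_complexity u n = card (language_n u n)"

definition pal_complexity :: "'a word \<Rightarrow> nat \<Rightarrow> nat" where
  "pal_complexity u n = card {w \<in> language_n u n. palindrome w}"

definition T :: "'a word \<Rightarrow> nat \<Rightarrow> int" where
  "T u n = int (factor_complexity u (n + 1)) - int (factor_complexity u n) + 2
           - int (pal_complexity u (n + 1)) - int (pal_complexity u n)"

definition defect :: "'a list \<Rightarrow> int" where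
  "defect w = int (length w) + 1 - int (card {v. sublist v w \<and> palindrome v})"

text \<open>The supremum may be infinite, hence the extended reals.\<close>

definition defect_inf :: "'a word \<Rightarrow> ereal" where
  "defect_inf u = (SUP n. ereal (real_of_int (defect (prefix n u))))"

end

theory Submission
  imports Defs
begin

text \<open>
  Form the undirected graph whose vertices are the factors of length \<open>n\<close> of a word \<open>x\<close> and whose
  edges are its non-palindromic factors of length \<open>n + 1\<close>, both up to reversal; an edge joins the
  classes of its prefix and its suffix of length \<open>n\<close>. Reading \<open>x\<close> from left to right walks through
  this graph, so it is connected and its cycle rank grows with \<open>x\<close>. Summed over all
  \<open>n < length x\<close>, the cycle ranks telescope to the defect of \<open>x\<close>. For a language closed under
  reversal, the cycle rank of the graph of \<open>u\<close> at level \<open>n\<close> is half of \<open>T u n\<close>, and it is attained on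
  a long enough prefix. Monotone convergence along the prefixes of \<open>u\<close> gives the theorem.
\<close>

section \<open>Counting words up to reversal\<close>

definition rev_class :: "'a list \<Rightarrow> 'a list set" where
  "rev_class v = {v, rev v}"

definition factors :: "nat \<Rightarrow> 'a list \<Rightarrow> 'a list set" where
  "factors n x = {v. sublist v x \<and> length v = n}"

text \<open>Edges minus vertices plus one. A palindromic edge would be a loop, since its two ends
  are reversals of each other. For \<open>n > length x\<close> the graph is empty and the formula
  gives 1, hence the bounds on \<open>n\<close> below.\<close>

definition cycle_rank :: "nat \<Rightarrow> 'a list \<Rightarrow> int" where
  "cycle_rank n x = int (card (rev_class ` {v \<in> factors (Suc n) x. \<not> palindrome v}))
     - int (card (rev_class ` factors n x)) + 1"

lemma rev_class_eq_iff: "rev_class v = rev_class w \<longleftrightarrow> v = w \<or> v = rev w"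
  by (auto simp: rev_class_def doubleton_eq_iff)

lemma finite_factors [simp]: "finite (factors n x)"
  by (rule finite_subset[of _ "set (sublists x)"]) (auto simp: factors_def)

lemma card_rev_class_split:
  assumes "finite X"
  shows "card (rev_class ` X)
    = card (rev_class ` {v \<in> X. \<not> palindrome v}) + card {v \<in> X. palindrome v}"
proof -
  have "rev_class ` X = rev_class ` {v \<in> X. \<not> palindrome v} \<union> rev_class ` {v \<in> X. palindrome v}"
    by auto
  moreover have "rev_class ` {v \<in> X. \<not> palindrome v} \<inter> rev_class ` {v \<in> X. palindrome v} = {}"
    by (auto simp: rev_class_eq_iff palindrome_def)
  moreover have "inj_on rev_class {v \<in> X. palindrome v}"
    by (auto simp: inj_on_def rev_class_eq_iff palindrome_def)
  ultimately show ?thesis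
    using assms by (simp add: card_Un_disjoint card_image)
qed

text \<open>The classes cut the non-palindromes into pairs; closure keeps both members of a pair in
  \<open>X\<close>.\<close>

lemma card_rev_class_nonpalindromes:
  assumes "finite X" and closed: "\<And>v. v \<in> X \<Longrightarrow> rev v \<in> X"
  shows "2 * card (rev_class ` {v \<in> X. \<not> palindrome v}) = card {v \<in> X. \<not> palindrome v}"
proof -
  let ?N = "{v \<in> X. \<not> palindrome v}"
  have union: "\<Union> (rev_class ` ?N) = ?N"
    using closed by (auto simp: rev_class_def palindrome_def)
  have "2 * card (rev_class ` ?N) = card (\<Union> (rev_class ` ?N))"
  proof (rule card_partition)
    show "finite (\<Union> (rev_class ` ?N))"
      using assms(1) unfolding union by simp
    show "card c = 2" if "c \<in> rev_class ` ?N" for c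
      using that by (auto simp: rev_class_def palindrome_def card_insert_if)
    show "c \<inter> d = {}" if "c \<in> rev_class ` ?N" "d \<in> rev_class ` ?N" "c \<noteq> d" for c d
      using that by (auto simp: rev_class_def)
  qed (use assms in simp)
  then show ?thesis
    unfolding union .
qed

section \<open>The defect as a sum of cycle ranks\<close>

lemma factors_0: "factors 0 x = {[]}"
  by (auto simp: factors_def)

lemma factors_length: "factors (length x) x = {x}"
proof -
  have "v = x" if "sublist v x" and len: "length v = length x" for v
  proof -
    obtain ps ss where x: "x = ps @ v @ ss"
      using \<open>sublist v x\<close> unfolding sublist_def by blast
    then have "length x = length ps + length v + length ss"
      by simp
    then have "length ps + length ss = 0"
      unfolding len by linarith
    then show ?thesis
      using x by simp
  qed
  then show ?thesis
    by (auto simp: factors_def)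
qed

lemma factors_longer: "length x < n \<Longrightarrow> factors n x = {}"
  by (auto simp: factors_def dest: sublist_length_le)

text \<open>The edges of level \<open>n\<close> are the vertices of level \<open>n + 1\<close> less
  the palindromes among them, so vertex counts of consecutive levels cancel. At level 0 the single
  vertex is offset by the empty palindrome.\<close>

lemma sum_cycle_rank:
  "(\<Sum>n<K. cycle_rank n x)
    = int (card (rev_class ` factors K x)) + int K
      - (\<Sum>n\<le>K. int (card {v \<in> factors n x. palindrome v}))"
proof (induction K)
  case 0
  have "{v \<in> {[]}. palindrome v} = {[] :: 'a list}"
    by (auto simp: palindrome_def)
  then show ?case
    by (simp add: factors_0)
next
  case (Suc K)
  then show ?case
    by (simp add: cycle_rank_def card_rev_class_split[of "factors (Suc K) x"])
qed

text \<open>At the top level the only vertex is the class of \<open>x\<close>, which supplies the 1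
  in the defect.\<close>

lemma defect_eq_sum_cycle_rank: "defect x = (\<Sum>n<length x. cycle_rank n x)"
proof -
  have "{v. sublist v x \<and> palindrome v} = (\<Union>n\<le>length x. {v \<in> factors n x. palindrome v})"
    by (auto simp: factors_def dest: sublist_length_le)
  moreover have "card (\<Union>n\<le>length x. {v \<in> factors n x. palindrome v})
      = (\<Sum>n\<le>length x. card {v \<in> factors n x. palindrome v})"
    by (rule card_UN_disjoint) (simp, simp, auto simp: factors_def)
  ultimately show ?thesis
    by (simp add: defect_def sum_cycle_rank factors_length)
qed

section \<open>Growth of the cycle rank as letters are appended\<close>

lemma factors_snoc:
  assumes "n \<le> Suc (length x)"
  shows "factors n (x @ [a]) = insert (drop (Suc (length x) - n) (x @ [a])) (factors n x)"
proof -
  have "v = drop (Suc (length x) - length v) (x @ [a])"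
    if suf: "Sublist.suffix v (x @ [a])" for v
  proof -
    obtain ps where v: "x @ [a] = ps @ v"
      using suf by (rule suffixE)
    have "Suc (length x) = length ps + length v"
      using arg_cong[OF v, of length] by simp
    then show ?thesis
      by (simp add: v)
  qed
  moreover have "sublist v (x @ [a]) \<longleftrightarrow> Sublist.suffix v (x @ [a]) \<or> sublist v x" for v
    by (rule sublist_snoc)
  ultimately show ?thesis
    using assms by (auto simp: factors_def suffix_drop simp del: suffix_snoc drop_append)
qed

text \<open>A letter adds at most the edge \<open>e\<close> and its end \<open>tl e\<close>. A new
  vertex always brings a new edge, from the old vertex \<open>b\<close>, so the rank cannot
  drop.\<close>

lemma cycle_rank_snoc:
  assumes "n \<le> length x"
  shows "cycle_rank n x \<le> cycle_rank n (x @ [a])"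
proof -
  define e where "e = drop (length x - n) (x @ [a])"
  define V where "V = rev_class ` factors n x"
  define N where "N = {v \<in> factors (Suc n) x. \<not> palindrome v}"
  define b where "b = drop (length x - n) x"
  have e: "e = b @ [a]" and len: "length b = n" and b: "sublist b x"
    using assms by (auto simp: e_def b_def)
  have "drop (Suc (length x) - n) (x @ [a]) = tl e"
    using assms by (simp only: e_def Suc_diff_le drop_Suc tl_drop)
  then have V': "rev_class ` factors n (x @ [a]) = insert (rev_class (tl e)) V"
    using assms by (simp add: factors_snoc V_def)
  have N': "{v \<in> factors (Suc n) (x @ [a]). \<not> palindrome v}
      = (if palindrome e then N else insert e N)"
    using assms by (auto simp: factors_snoc N_def e_def)
  have new_edge: "\<not> palindrome e \<and> rev_class e \<notin> rev_class ` N" if new: "rev_class (tl e) \<notin> V"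
  proof -
    have "length (tl e) = n"
      using len e by simp
    then have unseen: "\<not> sublist (tl e) x" "\<not> sublist (rev (tl e)) x"
      using new unfolding V_def factors_def image_iff rev_class_eq_iff
      by (metis (mono_tags, lifting) mem_Collect_eq length_rev rev_rev_ident)+
    \<comment> \<open>For a palindrome \<open>e\<close>, the end \<open>tl e\<close> would be the
      reversal of \<open>b\<close>, which already occurs in \<open>x\<close>.\<close>
    have "\<not> palindrome e"
    proof
      assume "palindrome e"
      then have "rev (tl e) = b"
        using e by (metis butlast_rev butlast_snoc palindrome_def)
      then show False
        using b unseen by simp
    qed
    \<comment> \<open>An occurrence of \<open>e\<close> or its reversal in \<open>x\<close> would
      contain \<open>tl e\<close> or its reversal.\<close>
    moreover have "rev_class e \<notin> rev_class ` N"
    proof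
      assume "rev_class e \<in> rev_class ` N"
      then have "sublist e x \<or> sublist (rev e) x"
        by (auto simp: N_def factors_def rev_class_eq_iff)
      then have "sublist (tl e) x \<or> sublist (rev (tl e)) x"
        by (metis sublist_tl sublist_rev sublist_order.order_trans)
      then show False
        using unseen by simp
    qed
    ultimately show ?thesis ..
  qed
  have fin: "finite V" "finite N"
    by (simp_all add: V_def N_def)
  have "int (card (rev_class ` N)) - int (card V)
      \<le> int (card (rev_class ` (if palindrome e then N else insert e N)))
        - int (card (insert (rev_class (tl e)) V))"
    using fin new_edge by (auto simp: card_insert_if)
  then show ?thesis
    unfolding cycle_rank_def V' N' by (simp flip: V_def N_def)
qed

lemma cycle_rank_length: "cycle_rank (length x) x = 0"
  by (simp add: cycle_rank_def factors_longer factors_length)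

lemma prefix_Suc: "prefix (Suc k) u = prefix k u @ [u k]"
  by (simp add: subsequence_def)

lemma cycle_rank_prefix_mono:
  assumes "n \<le> k" "k \<le> l"
  shows "cycle_rank n (prefix k u) \<le> cycle_rank n (prefix l u)"
  using assms(2)
proof (induction l rule: dec_induct)
  case (step l)
  have "cycle_rank n (prefix l u) \<le> cycle_rank n (prefix (Suc l) u)"
    using assms(1) step.hyps unfolding prefix_Suc by (intro cycle_rank_snoc) simp
  with step.IH show ?case
    by simp
qed simp

text \<open>The rank starts at 0 on the prefix of length \<open>n\<close>, whose graph is one vertex
  without edges.\<close>

lemma cycle_rank_prefix_nonneg:
  assumes "n \<le> k"
  shows "0 \<le> cycle_rank n (prefix k u)"
  using cycle_rank_prefix_mono[of n n k u] cycle_rank_length[of "prefix n u"] assms by simp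

section \<open>From prefixes to the language of the infinite word\<close>

lemma factors_prefix_subset: "factors n (prefix k u) \<subseteq> language_n u n"
proof
  fix v
  assume "v \<in> factors n (prefix k u)"
  then obtain ps ss where v: "prefix k u = ps @ v @ ss" and len: "length v = n"
    by (auto simp: factors_def sublist_def)
  have "length (prefix k u) = length ps + n + length ss"
    using v len by simp
  then have "v = u [length ps \<rightarrow> length ps + n]"
    using arg_cong[OF v, of "\<lambda>z. take n (drop (length ps) z)"] len by (simp add: min_def)
  then show "v \<in> language_n u n"
    using len by (auto simp: language_n_def language_def)
qed

lemma language_n_eq: "language_n u n = range (\<lambda>i. u [i \<rightarrow> i + n])"
  by (auto simp: language_n_def language_def)

lemma subsequence_in_factors_prefix:
  assumes "i + n \<le> k"
  shows "u [i \<rightarrow> i + n] \<in> factors n (prefix k u)"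
proof -
  have "u [i \<rightarrow> i + n] = take n (drop i (prefix k u))"
    using assms by (simp add: min_def)
  then have "sublist (u [i \<rightarrow> i + n]) (prefix k u)"
    by (metis sublist_take sublist_drop sublist_order.order_trans)
  then show ?thesis
    by (simp add: factors_def)
qed

lemma eventually_factors_prefix:
  assumes "finite (language_n u n)"
  shows "eventually (\<lambda>k. factors n (prefix k u) = language_n u n) sequentially"
proof -
  obtain I where I: "finite I" "language_n u n = (\<lambda>i. u [i \<rightarrow> i + n]) ` I"
    using assms finite_subset_image[of "language_n u n" _ UNIV]
    by (metis language_n_eq subset_refl)
  \<comment> \<open>The finite set \<open>I\<close> of starting positions reaches every factor of
    length \<open>n\<close>. Inserting 0 keeps \<open>Max\<close> meaningful without a case split on
    empty \<open>I\<close>.\<close>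
  have "factors n (prefix k u) = language_n u n" if "Max (insert 0 I) + n \<le> k" for k
  proof
    show "language_n u n \<subseteq> factors n (prefix k u)"
    proof
      fix v
      assume "v \<in> language_n u n"
      then obtain i where i: "i \<in> I" "v = u [i \<rightarrow> i + n]"
        using I by auto
      moreover have "i \<le> Max (insert 0 I)"
        using I i by simp
      ultimately show "v \<in> factors n (prefix k u)"
        using that by (auto intro: subsequence_in_factors_prefix)
    qed
  qed (rule factors_prefix_subset)
  then show ?thesis
    by (auto simp: eventually_sequentially)
qed

lemma finite_language_n:
  assumes "finite A" "range u \<subseteq> A"
  shows "finite (language_n u n)"
proof (rule finite_subset)
  show "language_n u n \<subseteq> {v. set v \<subseteq> A \<and> length v = n}"
    using assms(2) by (auto simp: language_n_eq image_subset_iff)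
qed (rule finite_lists_length_eq[OF assms(1)])

text \<open>Closure makes twice the edge count the number of non-palindromes of length
  \<open>n + 1\<close>, and twice the vertex count the number of words of length \<open>n\<close>
  plus the palindromes among them.\<close>

lemma T_eq_twice_cycle_rank:
  assumes fin: "\<And>n. finite (language_n u n)" and closed: "closed_under_reversal u"
    and n: "factors n x = language_n u n" and Suc: "factors (Suc n) x = language_n u (Suc n)"
  shows "T u n = 2 * cycle_rank n x"
proof -
  have rev: "rev v \<in> language_n u m" if "v \<in> language_n u m" for v m
    using that closed by (auto simp: language_n_def closed_under_reversal_def)
  have nonpal: "2 * card (rev_class ` {v \<in> language_n u m. \<not> palindrome v})
      = card {v \<in> language_n u m. \<not> palindrome v}" for m
    using fin rev by (rule card_rev_class_nonpalindromes)
  have split: "card (language_n u m)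
      = card {v \<in> language_n u m. palindrome v} + card {v \<in> language_n u m. \<not> palindrome v}" for m
    using card_Int_Diff[OF fin, of m "{v. palindrome v}"]
    by (simp add: Int_def set_diff_eq)
  show ?thesis
    using nonpal[of n] nonpal[of "Suc n"] split[of n] split[of "Suc n"]
    by (simp add: T_def factor_complexity_def pal_complexity_def cycle_rank_def n Suc
        card_rev_class_split[OF fin])
qed

section \<open>Comparison of the defect with the series\<close>

theorem theorem3p4:
  fixes u :: "'a word" and A :: "'a set"
  assumes "finite A" and "range u \<subseteq> A"
    and "closed_under_reversal u"
    and "defect_inf u < \<infinity>"
    and "summable (\<lambda>n. real_of_int (T u n))"
    and "\<And>M. \<exists>w \<in> language u. (\<forall>v \<in> language_n u M. sublist v w) \<and> w @ w \<in> language u"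
  shows "2 * defect_inf u = ereal (\<Sum>n. real_of_int (T u n))"
proof -
  have fin: "finite (language_n u n)" for n
    using assms(1,2) by (rule finite_language_n)
  have limit: "eventually (\<lambda>k. T u n = 2 * cycle_rank n (prefix k u)) sequentially" for n
    using eventually_factors_prefix[OF fin, of n] eventually_factors_prefix[OF fin, of "Suc n"]
    by eventually_elim (rule T_eq_twice_cycle_rank[OF fin assms(3)])
  \<comment> \<open>The rank is monotone in \<open>k\<close> and eventually reaches half of
    \<open>T u n\<close>.\<close>
  have bound: "2 * cycle_rank n (prefix k u) \<le> T u n" if "n \<le> k" for n k
  proof -
    obtain l where "k \<le> l" "T u n = 2 * cycle_rank n (prefix l u)"
      using eventually_conj[OF limit[of n] eventually_ge_at_top[of k]]
      by (auto simp: eventually_sequentially)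
    then show ?thesis
      using cycle_rank_prefix_mono[OF that] by simp
  qed
  have T_nonneg: "0 \<le> T u n" for n
    using bound[of n n] cycle_rank_length[of "prefix n u"] by simp
  let ?S = "\<Sum>n. real_of_int (T u n)"
  have upper: "2 * real_of_int (defect (prefix k u)) \<le> ?S" for k
  proof -
    have "2 * defect (prefix k u) = (\<Sum>n<k. 2 * cycle_rank n (prefix k u))"
      by (simp add: defect_eq_sum_cycle_rank sum_distrib_left)
    also have "\<dots> \<le> (\<Sum>n<k. T u n)"
      by (intro sum_mono bound) simp
    finally have "2 * real_of_int (defect (prefix k u)) \<le> (\<Sum>n<k. real_of_int (T u n))"
      by (metis of_int_le_iff of_int_mult of_int_numeral of_int_sum)
    also have "\<dots> \<le> ?S"
      using T_nonneg assms(5) by (intro sum_le_suminf) auto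
    finally show ?thesis .
  qed
  \<comment> \<open>This also rules out the value \<open>-\<infinity>\<close>, so the supremum is a
    real \<open>D\<close>.\<close>
  have le_D: "ereal (real_of_int (defect (prefix k u))) \<le> defect_inf u" for k
    unfolding defect_inf_def by (rule SUP_upper) simp
  then obtain D where D: "defect_inf u = ereal D"
    using assms(4) by (cases "defect_inf u") auto
  have "?S \<le> 2 * D"
  proof (rule suminf_le_const[OF assms(5)])
    fix N
    \<comment> \<open>Finitely many levels share one prefix that attains all their limits.\<close>
    have "eventually (\<lambda>k. \<forall>n\<in>{..<N}. T u n = 2 * cycle_rank n (prefix k u)) sequentially"
      by (intro eventually_ball_finite ballI limit) simp
    then have "eventually (\<lambda>k. N \<le> k \<and> (\<forall>n<N. T u n = 2 * cycle_rank n (prefix k u)))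
        sequentially"
      using eventually_ge_at_top[of N] by eventually_elim simp
    then obtain k where "N \<le> k" and k: "\<forall>n<N. T u n = 2 * cycle_rank n (prefix k u)"
      by (auto simp: eventually_sequentially)
    have "(\<Sum>n<N. T u n) = (\<Sum>n<N. 2 * cycle_rank n (prefix k u))"
      using k by simp
    \<comment> \<open>The added levels from \<open>N\<close> up to \<open>k - 1\<close> contribute
      nonnegative ranks.\<close>
    also have "\<dots> \<le> (\<Sum>n<k. 2 * cycle_rank n (prefix k u))"
      using \<open>N \<le> k\<close> by (intro sum_mono2) (auto intro: cycle_rank_prefix_nonneg)
    also have "\<dots> = 2 * defect (prefix k u)"
      by (simp add: defect_eq_sum_cycle_rank sum_distrib_left)
    finally have "(\<Sum>n<N. real_of_int (T u n)) \<le> 2 * real_of_int (defect (prefix k u))"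
      by (metis of_int_le_iff of_int_mult of_int_numeral of_int_sum)
    also have "\<dots> \<le> 2 * D"
      using le_D[of k] D by simp
    finally show "(\<Sum>n<N. real_of_int (T u n)) \<le> 2 * D" .
  qed
  moreover have "defect_inf u \<le> ereal (?S / 2)"
    unfolding defect_inf_def using upper by (intro SUP_least) (simp add: field_simps)
  ultimately show ?thesis
    using D by simp
qed

end
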